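(* Let $a\ge b>0$, let $r=\frac{ab}{a+b}$, and let $s=\sqrt{\frac{b^4+2ab^3}{a^4+2ba^3}}$. Then for every triangle in the incircle family with parameters $a,b$, and for every triangle in its image under the scaling $(x,y)\mapsto(s\,x,y)$ (which is a confocal family), the internal angles $\theta_1,\theta_2,\theta_3$ satisfy $$\sum_{i=1}^3\cos\theta_i=k,\qquad k=1+\frac{2ab}{(a+b)^2}=1+\frac{2r(a-r)}{a^2}.$$
   Context: Incircle family with parameters $a,b$: the set of all (nondegenerate) triangles inscribed in the ellipse $x^2/a^2+y^2/b^2=1$ whose three sides are tangent to the concentric circle of radius $r=ab/(a+b)$ centered at the origin. (By Poncelet's porism, with this value of $r$, every point of the ellipse is a vertex of exactly one such triangle.) Confocal family: for an ellipse and a confocal ellipse inside it such that triangles inscribed in the outer one and circumscribed about the inner one exist, the set of all such triangles. *)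

theory Defs
  imports "HOL-Analysis.Analysis"
begin

type_synonym point = "real \<times> real"

(* A triangle is given by its ordered vertices; the families below are closed under permuting them. *)
type_synonym triangle = "point \<times> point \<times> point"

definition angle :: "point \<Rightarrow> point \<Rightarrow> point \<Rightarrow> real" where
  "angle P V Q = arccos (((P - V) \<bullet> (Q - V)) / (norm (P - V) * norm (Q - V)))"

(* Left-hand side of the equation of the ellipse with semi-axes p, q along the x- and y-axis. *)
definition ellipse_fun :: "real \<Rightarrow> real \<Rightarrow> point \<Rightarrow> real" where
  "ellipse_fun p q z = (fst z)\<^sup>2 / p\<^sup>2 + (snd z)\<^sup>2 / q\<^sup>2"

definition ellipse :: "real \<Rightarrow> real \<Rightarrow> point set" where
  "ellipse p q = {z. ellipse_fun p q z = 1}"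

(* Circles about the origin are the ellipses with equal semi-axes. *)
lemma ellipse_eq_sphere:
  assumes "r > 0"
  shows "ellipse r r = sphere 0 r"
proof -
  have "(fst z)\<^sup>2 / r\<^sup>2 + (snd z)\<^sup>2 / r\<^sup>2 = 1 \<longleftrightarrow> norm z = r" for z :: point
  proof -
    have "(fst z)\<^sup>2 / r\<^sup>2 + (snd z)\<^sup>2 / r\<^sup>2 = 1 \<longleftrightarrow> (norm z)\<^sup>2 = r\<^sup>2"
      using assms by (auto simp: norm_prod_def field_simps)
    also have "\<dots> \<longleftrightarrow> norm z = r"
      using assms by (simp add: power2_eq_iff_nonneg)
    finally show ?thesis .
  qed
  then show ?thesis
    by (auto simp: ellipse_def ellipse_fun_def)
qed

(* The side PQ touches the ellipse at some z: z lies on both, and the direction of PQ is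
   tangent to the level curve at z, i.e. annihilated by the derivative there. *)
definition side_tangent_ellipse :: "point \<Rightarrow> point \<Rightarrow> real \<Rightarrow> real \<Rightarrow> bool" where
  "side_tangent_ellipse P Q p q \<longleftrightarrow>
     (\<exists>z \<in> ellipse p q \<inter> closed_segment P Q.
        \<exists>D. (ellipse_fun p q has_derivative D) (at z) \<and> D (Q - P) = 0)"

definition inscribed_circumscribed :: "real \<Rightarrow> real \<Rightarrow> real \<Rightarrow> real \<Rightarrow> triangle set" where
  "inscribed_circumscribed p q p' q' =
     {(A, B, C). \<not> collinear {A, B, C} \<and> {A, B, C} \<subseteq> ellipse p q \<and>
        side_tangent_ellipse A B p' q' \<and> side_tangent_ellipse B C p' q' \<and>
        side_tangent_ellipse C A p' q'}"

definition incircle_family :: "real \<Rightarrow> real \<Rightarrow> triangle set" where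
  "incircle_family a b = inscribed_circumscribed a b (a * b / (a + b)) (a * b / (a + b))"

(* The major axis may be either coordinate axis; for p = q both foci coincide with the centre. *)
definition foci :: "real \<Rightarrow> real \<Rightarrow> point set" where
  "foci p q =
     (if q \<le> p then {(sqrt (p\<^sup>2 - q\<^sup>2), 0), (- sqrt (p\<^sup>2 - q\<^sup>2), 0)}
      else {(0, sqrt (q\<^sup>2 - p\<^sup>2)), (0, - sqrt (q\<^sup>2 - p\<^sup>2))})"

(* Any confocal pair of ellipses can be brought to this centred, axis-parallel position by a rigid motion. *)
definition is_confocal_family :: "triangle set \<Rightarrow> bool" where
  "is_confocal_family F \<longleftrightarrow>
     (\<exists>p q p' q'. 0 < p' \<and> p' < p \<and> 0 < q' \<and> q' < q \<and> foci p q = foci p' q' \<and>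
        F = inscribed_circumscribed p q p' q' \<and> F \<noteq> {})"

definition scale_point :: "real \<Rightarrow> point \<Rightarrow> point" where
  "scale_point s = (\<lambda>(x, y). (s * x, y))"

definition scale_triangle :: "real \<Rightarrow> triangle \<Rightarrow> triangle" where
  "scale_triangle s = (\<lambda>(A, B, C). (scale_point s A, scale_point s B, scale_point s C))"

end

theory Submission
  imports Defs
begin

text \<open>
  Divide the coordinates of each vertex by the semi-axes to get unit vectors $u$, $v$, $w$, with
  $u = (c, s)$ over the vertex $(ac, bs)$. The radius $r$ satisfies $1/r = 1/a + 1/b$, and this is
  exactly what turns the condition ``the chord over $u$, $v$ touches the circle of radius $r$'',
  quadratic for a general radius, into the bilinear condition
  $a\,c\,c' + b\,s\,s' = -r$ (lemma \<open>tangent_imp_conjugate\<close>). Hence the vectors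
  $(\sqrt a\,c, \sqrt b\,s, \sqrt r)$ over the three vertices are pairwise orthogonal in space. The
  whole proof lives on this orthogonality.

  Subtracting two of the bilinear conditions shows that each side of the triangle is perpendicular
  to the unit vector of the opposite vertex, and the origin being inside fixes the
  orientations (lemma \<open>conjugate_sides\<close>). So the cosine of an angle of the triangle, or of
  its image under $(x,y) \mapsto (\sigma x, y)$, can be read off the unit vectors of the two other
  vertices (lemma \<open>cos_angle_vertex\<close>).

  For the incircle family this gives $\cos\theta_u = - v \cdot w$, so the sum of the cosines is
  $(3 - |u + v + w|^2)/2$. Given the vertex $A$ over $u$, the vectors $v$, $w$ are the
  intersections of the unit circle with a line, whence $v + w = -2rA/|A|^2$, and
  $|u + v + w|$ comes out as $(a - b)/(a + b)$.

  For the confocal family the same intersection gives $\cos\theta_u = K/n_u - 1$ where $K$ is a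
  constant and $n_u = a c^2 + b s^2 + r$ is the squared length of the spatial vector over $u$;
  the scaling factor of the theorem is the one that makes the scaled ellipses confocal. Normalizing
  the three spatial vectors gives an orthonormal basis, whose third coordinates have
  $\sum r/n = 1$ (lemma \<open>sum_inverse_weight\<close>), and the sum of the cosines follows.
\<close>

section \<open>Angles, tangency and scaling\<close>

lemma cos_angle:
  "cos (angle P V Q) = ((P - V) \<bullet> (Q - V)) / (norm (P - V) * norm (Q - V))"
proof -
  have "\<bar>((P - V) \<bullet> (Q - V)) / (norm (P - V) * norm (Q - V))\<bar> \<le> 1"
    using Cauchy_Schwarz_ineq2[of "P - V" "Q - V"]
    by (cases "norm (P - V) * norm (Q - V) = 0") (auto simp: abs_mult)
  then show ?thesis
    by (simp add: angle_def cos_arccos_abs)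
qed

lemma has_derivative_ellipse_fun:
  "(ellipse_fun p q has_derivative
     (\<lambda>h. 2 * fst z * fst h / p\<^sup>2 + 2 * snd z * snd h / q\<^sup>2)) (at z)"
  unfolding ellipse_fun_def divide_inverse
  by (auto intro!: derivative_eq_intros simp: fun_eq_iff algebra_simps)

lemma side_tangent_ellipse_iff:
  "side_tangent_ellipse P Q p q \<longleftrightarrow>
     (\<exists>z \<in> ellipse p q \<inter> closed_segment P Q.
        fst z * fst (Q - P) / p\<^sup>2 + snd z * snd (Q - P) / q\<^sup>2 = 0)"
proof -
  have "(\<exists>D. (ellipse_fun p q has_derivative D) (at z) \<and> D h = 0) \<longleftrightarrow>
      fst z * fst h / p\<^sup>2 + snd z * snd h / q\<^sup>2 = 0" for z h
  proof -
    have "(\<exists>D. (ellipse_fun p q has_derivative D) (at z) \<and> D h = 0) \<longleftrightarrow>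
        2 * fst z * fst h / p\<^sup>2 + 2 * snd z * snd h / q\<^sup>2 = 0"
      using has_derivative_ellipse_fun[of p q z] has_derivative_unique by blast
    also have "\<dots> \<longleftrightarrow> 2 * (fst z * fst h / p\<^sup>2 + snd z * snd h / q\<^sup>2) = 0"
      by (simp add: distrib_left mult.assoc)
    finally show ?thesis
      by (simp only: mult_eq_0_iff) simp
  qed
  then show ?thesis
    by (simp add: side_tangent_ellipse_def)
qed

lemma side_tangent_ellipse_commute:
  "side_tangent_ellipse P Q p q \<longleftrightarrow> side_tangent_ellipse Q P p q"
proof -
  have "side_tangent_ellipse Q P p q" if "side_tangent_ellipse P Q p q" for P Q
  proof -
    from that obtain z where z: "z \<in> ellipse p q" "z \<in> closed_segment P Q"
        "fst z * fst (Q - P) / p\<^sup>2 + snd z * snd (Q - P) / q\<^sup>2 = 0"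
      by (auto simp: side_tangent_ellipse_iff)
    have "fst z * fst (P - Q) / p\<^sup>2 + snd z * snd (P - Q) / q\<^sup>2 =
        - (fst z * fst (Q - P) / p\<^sup>2 + snd z * snd (Q - P) / q\<^sup>2)"
      by (simp add: right_diff_distrib diff_divide_distrib)
    also have "\<dots> = 0"
      unfolding z(3) by simp
    finally show ?thesis
      using z(1,2) unfolding side_tangent_ellipse_iff closed_segment_commute[of Q P] by blast
  qed
  then show ?thesis
    by blast
qed

lemma linear_scale_point: "linear (scale_point s)"
  by (rule linearI) (auto simp: scale_point_def split: prod.splits simp: algebra_simps)

lemma scale_point_inverse: "s \<noteq> 0 \<Longrightarrow> scale_point s (scale_point (1 / s) z) = z"
  by (auto simp: scale_point_def split: prod.splits)

lemma collinear_linear_image: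
  assumes "linear f" "collinear S"
  shows "collinear (f ` S)"
proof -
  from assms(2) obtain u where u: "\<And>x y. x \<in> S \<Longrightarrow> y \<in> S \<Longrightarrow> \<exists>c. x - y = c *\<^sub>R u"
    unfolding collinear_def by blast
  have "\<exists>c. f x - f y = c *\<^sub>R f u" if "x \<in> S" "y \<in> S" for x y
    using u[OF that] assms(1) by (metis linear_diff linear_scale)
  then show ?thesis
    unfolding collinear_def by blast
qed

lemma scale_point_in_ellipse_iff:
  assumes "s \<noteq> 0"
  shows "scale_point s z \<in> ellipse (s * p) q \<longleftrightarrow> z \<in> ellipse p q"
  using assms by (simp add: ellipse_def ellipse_fun_def scale_point_def split_beta power_mult_distrib)

lemma side_tangent_ellipse_scale_point:
  assumes "s \<noteq> 0" "side_tangent_ellipse P Q p q"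
  shows "side_tangent_ellipse (scale_point s P) (scale_point s Q) (s * p) q"
proof -
  obtain z where z: "z \<in> ellipse p q" "z \<in> closed_segment P Q"
      "fst z * fst (Q - P) / p\<^sup>2 + snd z * snd (Q - P) / q\<^sup>2 = 0"
    using assms(2) by (auto simp: side_tangent_ellipse_iff)
  have "scale_point s z \<in> closed_segment (scale_point s P) (scale_point s Q)"
    using z(2) closed_segment_linear_image[OF linear_scale_point, of s P Q] by blast
  moreover have "scale_point s z \<in> ellipse (s * p) q"
    using z(1) assms(1) by (simp add: scale_point_in_ellipse_iff)
  moreover have "fst (scale_point s z) * fst (scale_point s Q - scale_point s P) / (s * p)\<^sup>2
      + snd (scale_point s z) * snd (scale_point s Q - scale_point s P) / q\<^sup>2 =
      fst z * fst (Q - P) / p\<^sup>2 + snd z * snd (Q - P) / q\<^sup>2"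
  proof -
    have "fst (scale_point s z) * fst (scale_point s Q - scale_point s P) =
        s\<^sup>2 * (fst z * fst (Q - P))"
      by (simp add: scale_point_def split_beta power2_eq_square algebra_simps)
    moreover have "snd (scale_point s w) = snd w" for w
      by (simp add: scale_point_def split_beta)
    ultimately show ?thesis
      unfolding snd_diff power_mult_distrib using assms(1) by simp
  qed
  ultimately show ?thesis
    using z(3) unfolding side_tangent_ellipse_iff by (metis IntI)
qed

lemma scale_triangle_inscribed_circumscribed:
  assumes "T \<in> inscribed_circumscribed p q p' q'" "s \<noteq> 0"
  shows "scale_triangle s T \<in> inscribed_circumscribed (s * p) q (s * p') q'"
proof -
  obtain A B C where T: "T = (A, B, C)"
    by (cases T)
  have "\<not> collinear {scale_point s A, scale_point s B, scale_point s C}"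
  proof
    assume "collinear {scale_point s A, scale_point s B, scale_point s C}"
    then have "collinear (scale_point (1 / s) ` {scale_point s A, scale_point s B, scale_point s C})"
      by (rule collinear_linear_image[OF linear_scale_point])
    then show False
      using assms scale_point_inverse[of "1 / s"]
      by (simp add: T inscribed_circumscribed_def)
  qed
  then show ?thesis
    using assms side_tangent_ellipse_scale_point
    by (auto simp: T inscribed_circumscribed_def scale_triangle_def scale_point_in_ellipse_iff)
qed

lemma image_scale_triangle_inscribed_circumscribed:
  assumes "s \<noteq> 0"
  shows "scale_triangle s ` inscribed_circumscribed p q p' q' =
    inscribed_circumscribed (s * p) q (s * p') q'"
proof
  show "scale_triangle s ` inscribed_circumscribed p q p' q' \<subseteq>
      inscribed_circumscribed (s * p) q (s * p') q'"
    using assms scale_triangle_inscribed_circumscribed by blast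
  show "inscribed_circumscribed (s * p) q (s * p') q' \<subseteq>
      scale_triangle s ` inscribed_circumscribed p q p' q'"
  proof
    fix T
    assume "T \<in> inscribed_circumscribed (s * p) q (s * p') q'"
    then have "scale_triangle (1 / s) T \<in> inscribed_circumscribed p q p' q'"
      using scale_triangle_inscribed_circumscribed[of T "s * p" q "s * p'" q' "1 / s"] assms
      by simp
    moreover have "scale_triangle s (scale_triangle (1 / s) T) = T"
      using assms by (cases T) (simp add: scale_triangle_def scale_point_inverse)
    ultimately show "T \<in> scale_triangle s ` inscribed_circumscribed p q p' q'"
      by (metis imageI)
  qed
qed

section \<open>Tangent chords as conjugate unit vectors\<close>

definition vertex :: "real \<Rightarrow> real \<Rightarrow> point \<Rightarrow> point" where
  "vertex p q u = (p * fst u, q * snd u)"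

lemma ellipse_eq_vertex_image:
  assumes "p > 0" "q > 0"
  shows "ellipse p q = vertex p q ` sphere 0 1"
proof -
  have "z \<in> vertex p q ` sphere 0 1" if "z \<in> ellipse p q" for z
  proof
    show "z = vertex p q (fst z / p, snd z / q)"
      using assms by (simp add: vertex_def)
    show "(fst z / p, snd z / q) \<in> sphere 0 1"
      using that by (simp add: ellipse_def ellipse_fun_def norm_Pair power_divide)
  qed
  moreover have "vertex p q u \<in> ellipse p q" if "u \<in> sphere 0 1" for u
    using that assms
    by (simp add: ellipse_def ellipse_fun_def vertex_def norm_prod_def power_mult_distrib)
  ultimately show ?thesis
    by blast
qed

text \<open>
  Polarity of the points \<open>vertex a b u\<close> and \<open>vertex a b v\<close> with respect to the imaginary conic
  $x^2/a + y^2/b + r = 0$ with $r = ab/(a+b)$.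
\<close>

definition conjugate :: "real \<Rightarrow> real \<Rightarrow> point \<Rightarrow> point \<Rightarrow> bool" where
  "conjugate a b u v \<longleftrightarrow> a * fst u * fst v + b * snd u * snd v = - (a * b / (a + b))"

text \<open>
  The distance of the chord from the origin gives an equation of degree four. With
  $d = \cos(t_1 - t_2)$ and $e = \cos(t_1 + t_2)$ for the eccentric angles $t_1$, $t_2$, it
  has the factor $1 - d$, which is nonzero for distinct points, and the remaining equation is linear
  in $d$ and $e$. For $r(a + b) = ab$ it is a multiple of $(a+b)\,d + (a-b)\,e = -2r$, which
  is the bilinear condition because $d \pm e$ are $2cc'$ and $2ss'$.
\<close>

lemma tangent_imp_conjugate:
  assumes ab: "a > 0" "b > 0" and r: "r = a * b / (a + b)"
    and unit: "norm u = 1" "norm v = 1" and neq: "u \<noteq> v"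
    and tangent: "side_tangent_ellipse (vertex a b u) (vertex a b v) r r"
  shows "conjugate a b u v"
proof -
  obtain c1 s1 c2 s2 where uv: "u = (c1, s1)" "v = (c2, s2)"
    by (cases u, cases v)
  have cs: "c1\<^sup>2 + s1\<^sup>2 = 1" "c2\<^sup>2 + s2\<^sup>2 = 1"
    using unit by (auto simp: uv norm_Pair)
  have r0: "r > 0"
    using ab r by simp
  obtain z where z: "z \<in> ellipse r r" "z \<in> closed_segment (vertex a b u) (vertex a b v)"
      "fst z * fst (vertex a b v - vertex a b u) / r\<^sup>2 +
       snd z * snd (vertex a b v - vertex a b u) / r\<^sup>2 = 0"
    using tangent by (auto simp: side_tangent_ellipse_iff)
  obtain x y where xy: "z = (x, y)"
    by (cases z)
  define d1 d2 where "d1 = a * (c2 - c1)" and "d2 = b * (s2 - s1)"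
  have zr: "x\<^sup>2 + y\<^sup>2 = r\<^sup>2"
    using z(1) r0 by (simp add: ellipse_def ellipse_fun_def xy field_simps)
  have "x * d1 / r\<^sup>2 + y * d2 / r\<^sup>2 = 0"
    using z(3) by (simp add: xy uv vertex_def d1_def d2_def algebra_simps)
  then have perp: "x * d1 + y * d2 = 0"
    using r0 by (simp add: field_simps)
  obtain t where t: "z = (1 - t) *\<^sub>R vertex a b u + t *\<^sub>R vertex a b v"
    using z(2) by (auto simp: closed_segment_def)
  have xyt: "x = a * c1 + t * d1" "y = b * s1 + t * d2"
    using t by (auto simp: xy uv vertex_def d1_def d2_def algebra_simps)
  \<comment> \<open>Both sides are twice the signed area of the triangle formed by the chord and the origin.\<close>
  have "a * b * (c1 * s2 - s1 * c2) = x * d2 - y * d1"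
    unfolding xyt by (simp add: d1_def d2_def algebra_simps)
  then have "(a * b * (c1 * s2 - s1 * c2))\<^sup>2 = (x * d2 - y * d1)\<^sup>2 + (x * d1 + y * d2)\<^sup>2"
    by (simp add: perp)
  also have "\<dots> = r\<^sup>2 * (d1\<^sup>2 + d2\<^sup>2)"
    unfolding zr[symmetric] by (simp add: power2_eq_square algebra_simps)
  finally have dist: "(a * b)\<^sup>2 * (c1 * s2 - s1 * c2)\<^sup>2 =
      r\<^sup>2 * (a\<^sup>2 * (c2 - c1)\<^sup>2 + b\<^sup>2 * (s2 - s1)\<^sup>2)"
    by (simp add: d1_def d2_def power_mult_distrib)
  define d e where "d = c1 * c2 + s1 * s2" and "e = c1 * c2 - s1 * s2"
  have 1: "(c1 * s2 - s1 * c2)\<^sup>2 = (1 - d) * (1 + d)"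
    using cs unfolding d_def by algebra
  have 2: "(c2 - c1)\<^sup>2 = (1 - d) * (1 - e)"
    using cs unfolding d_def e_def by algebra
  have 3: "(s2 - s1)\<^sup>2 = (1 - d) * (1 + e)"
    using cs unfolding d_def e_def by algebra
  have d1: "1 - d \<noteq> 0"
  proof
    assume "1 - d = 0"
    with 2 3 have "u = v"
      by (simp add: uv)
    with neq show False ..
  qed
  have rab: "r * (a + b) = a * b"
    using ab r by simp
  have "(1 - d) * (r\<^sup>2 * ((a + b)\<^sup>2 * (1 + d))) = (1 - d) * (r\<^sup>2 * (a\<^sup>2 * (1 - e) + b\<^sup>2 * (1 + e)))"
    using dist[unfolded 1 2 3] rab by algebra
  then have "(a + b)\<^sup>2 * (1 + d) = a\<^sup>2 * (1 - e) + b\<^sup>2 * (1 + e)"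
    using d1 r0 by simp
  then have "(a + b) * (2 * (a * c1 * c2 + b * s1 * s2)) = - 2 * (a * b)"
    unfolding d_def e_def by algebra
  then show ?thesis
    using ab by (simp add: conjugate_def uv field_simps)
qed

definition conjugate_triple :: "real \<Rightarrow> real \<Rightarrow> point \<Rightarrow> point \<Rightarrow> point \<Rightarrow> bool" where
  "conjugate_triple a b u v w \<longleftrightarrow> norm u = 1 \<and> norm v = 1 \<and> norm w = 1 \<and>
     conjugate a b u v \<and> conjugate a b v w \<and> conjugate a b w u"

lemma conjugate_triple_rotate: "conjugate_triple a b u v w \<Longrightarrow> conjugate_triple a b v w u"
  by (simp add: conjugate_triple_def)

lemma incircle_family_conjugate_triple:
  assumes ab: "a > 0" "b > 0" and T: "(A, B, C) \<in> incircle_family a b"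
  obtains u v w where "conjugate_triple a b u v w"
    "A = vertex a b u" "B = vertex a b v" "C = vertex a b w"
proof -
  have "A \<in> ellipse a b" "B \<in> ellipse a b" "C \<in> ellipse a b"
    using T by (auto simp: incircle_family_def inscribed_circumscribed_def)
  then obtain u v w where uvw: "norm u = 1" "norm v = 1" "norm w = 1"
      "A = vertex a b u" "B = vertex a b v" "C = vertex a b w"
    by (auto simp: ellipse_eq_vertex_image[OF ab])
  have "\<not> collinear {A, B, C}"
    using T by (auto simp: incircle_family_def inscribed_circumscribed_def)
  then have "u \<noteq> v" "v \<noteq> w" "w \<noteq> u"
    by (auto simp: uvw insert_commute)
  then have "conjugate_triple a b u v w"
    using T uvw tangent_imp_conjugate[OF ab refl]
    by (auto simp: conjugate_triple_def incircle_family_def inscribed_circumscribed_def)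
  with uvw that show thesis
    by blast
qed

text \<open>
  The vectors conjugate to $u$ form a line with normal vector \<open>vertex a b u\<close>, so $v$ and $w$ are its
  two intersections with the unit circle. The conclusions are Vieta's formulas: the first one
  says that the midpoint of $v$ and $w$ is the foot of the perpendicular from the origin.
\<close>

lemma conjugate_points_sum_product:
  assumes ab: "a > 0" "b > 0" and r: "r = a * b / (a + b)"
    and unit: "norm v = 1" "norm w = 1" and neq: "v \<noteq> w"
    and conj: "conjugate a b u v" "conjugate a b u w"
    and D: "D = (a * fst u)\<^sup>2 + (b * snd u)\<^sup>2"
  shows "D *\<^sub>R (v + w) = (- 2 * r) *\<^sub>R vertex a b u"
    and "D * (fst v * fst w) = r\<^sup>2 - (b * snd u)\<^sup>2"
    and "D * (snd v * snd w) = r\<^sup>2 - (a * fst u)\<^sup>2"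
    and "D > 0"
proof -
  obtain c1 s1 c2 s2 c3 s3 where uvw: "u = (c1, s1)" "v = (c2, s2)" "w = (c3, s3)"
    by (cases u, cases v, cases w)
  have cs: "c2\<^sup>2 + s2\<^sup>2 = 1" "c3\<^sup>2 + s3\<^sup>2 = 1"
    using unit by (auto simp: uvw norm_Pair)
  define x y where "x = a * c1" and "y = b * s1"
  have r0: "r > 0"
    using ab r by simp
  have line: "x * c2 + y * s2 = - r" "x * c3 + y * s3 = - r"
    using conj by (simp_all add: conjugate_def uvw r x_def y_def)
  have Dxy: "D = x\<^sup>2 + y\<^sup>2"
    by (simp add: D uvw x_def y_def)
  have "\<not> (x = 0 \<and> y = 0)"
    using line(1) r0 by auto
  then show D0: "D > 0"
    by (simp add: Dxy sum_power2_gt_zero_iff)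
  \<comment> \<open>K measures how far the sum of v and w is from being parallel to the normal (x, y).\<close>
  define K where "K = (c2 + c3) * y - (s2 + s3) * x"
  have "K * (c3 - c2) = 0" "K * (s3 - s2) = 0"
    unfolding K_def using line cs by algebra+
  then have K0: "K = 0"
    using neq by (auto simp: uvw)
  have sum: "D * (c2 + c3) = - 2 * r * x" "D * (s2 + s3) = - 2 * r * y"
    using K0 line unfolding K_def Dxy by algebra+
  then show "D *\<^sub>R (v + w) = (- 2 * r) *\<^sub>R vertex a b u"
    by (simp add: uvw vertex_def x_def y_def)
  \<comment> \<open>The squared length of D (v + w), computed once from the norms and once from the sum.\<close>
  have "D * (2 * D * (c2 * c3 + s2 * s3) + 2 * D) = (D * (c2 + c3))\<^sup>2 + (D * (s2 + s3))\<^sup>2"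
    using cs by algebra
  also have "\<dots> = D * (4 * r\<^sup>2)"
    using sum Dxy by algebra
  finally have inner: "D * (c2 * c3 + s2 * s3) = 2 * r\<^sup>2 - D"
    using D0 by simp
  have "D * (D * (c2 * c3)) = D * (r\<^sup>2 - y\<^sup>2)"
    using line sum(2) inner Dxy by algebra
  then have cc: "D * (c2 * c3) = r\<^sup>2 - y\<^sup>2"
    using D0 by simp
  then show "D * (fst v * fst w) = r\<^sup>2 - (b * snd u)\<^sup>2"
    by (simp add: uvw y_def)
  show "D * (snd v * snd w) = r\<^sup>2 - (a * fst u)\<^sup>2"
    using cc inner Dxy by (simp add: uvw x_def algebra_simps)
qed

section \<open>Sides of a triangle of pairwise conjugate vertices\<close>

text \<open>
  The squared length of the vector $(\sqrt a\,c, \sqrt b\,s, \sqrt r)$ over $u = (c, s)$.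
\<close>

definition weight :: "real \<Rightarrow> real \<Rightarrow> point \<Rightarrow> real" where
  "weight a b u = a * (fst u)\<^sup>2 + b * (snd u)\<^sup>2 + a * b / (a + b)"

lemma weight_pos:
  assumes "a > 0" "b > 0"
  shows "weight a b u > 0"
  unfolding weight_def using assms by (intro add_nonneg_pos) auto

text \<open>
  A self-conjugate vector would have weight zero.
\<close>

lemma conjugate_triple_distinct:
  assumes "a > 0" "b > 0" "conjugate_triple a b u v w"
  shows "v \<noteq> w"
proof
  assume "v = w"
  then have "a * (fst v)\<^sup>2 + b * (snd v)\<^sup>2 = - (a * b / (a + b))"
    using assms(3) by (simp add: conjugate_triple_def conjugate_def power2_eq_square algebra_simps)
  then show False
    using weight_pos[OF assms(1,2), of v] by (simp add: weight_def)
qed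

text \<open>
  Two vertices conjugate to the third one differ by a vector perpendicular to the unit vector of
  the third, so the $t_i$ are the side lengths up to sign. The products $t_i t_j$ come out
  positive, so all $t_i$ have the same sign: this is how the proof knows that the origin lies
  inside the triangle. The last identity computes twice the
  signed area in two ways, as $r(t_1 + t_2 + t_3)$ and as the cross product of two sides.
\<close>

lemma conjugate_sides:
  assumes ab: "a > 0" "b > 0" and triple: "conjugate_triple a b u v w"
  obtains t1 t2 t3 where
    "vertex a b w - vertex a b v = t1 *\<^sub>R (snd u, - fst u)"
    "vertex a b u - vertex a b w = t2 *\<^sub>R (snd v, - fst v)"
    "vertex a b v - vertex a b u = t3 *\<^sub>R (snd w, - fst w)"
    "t2 * t3 = (a + b) * weight a b u" "t3 * t1 = (a + b) * weight a b v"
    "t1 * t2 = (a + b) * weight a b w"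
    "t1 * t2 * t3 = a * b * (t1 + t2 + t3)"
proof -
  obtain c1 s1 c2 s2 c3 s3 where uvw: "u = (c1, s1)" "v = (c2, s2)" "w = (c3, s3)"
    by (cases u, cases v, cases w)
  define r where "r = a * b / (a + b)"
  have rab: "r * (a + b) = a * b"
    using ab r_def by simp
  have cs: "c1\<^sup>2 + s1\<^sup>2 = 1" "c2\<^sup>2 + s2\<^sup>2 = 1" "c3\<^sup>2 + s3\<^sup>2 = 1"
    using triple by (auto simp: conjugate_triple_def uvw norm_Pair)
  have r3: "a * c1 * c2 + b * s1 * s2 = - r" "a * c2 * c3 + b * s2 * s3 = - r"
      "a * c3 * c1 + b * s3 * s1 = - r"
    using triple by (auto simp: conjugate_triple_def conjugate_def uvw r_def)
  define t1 t2 t3 where "t1 = a * (c3 - c2) * s1 - b * (s3 - s2) * c1"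
    and "t2 = a * (c1 - c3) * s2 - b * (s1 - s3) * c2"
    and "t3 = a * (c2 - c1) * s3 - b * (s2 - s1) * c3"
  have d1: "a * (c3 - c2) = t1 * s1" "b * (s3 - s2) = - (t1 * c1)"
    using cs(1) r3 unfolding t1_def by algebra+
  have d2: "a * (c1 - c3) = t2 * s2" "b * (s1 - s3) = - (t2 * c2)"
    using cs(2) r3 unfolding t2_def by algebra+
  have d3: "a * (c2 - c1) = t3 * s3" "b * (s2 - s1) = - (t3 * c3)"
    using cs(3) r3 unfolding t3_def by algebra+
  \<comment> \<open>The sides are at distance r from the origin, so the areas over them are r times the t's.\<close>
  have x3: "a * b * (c1 * s2 - s1 * c2) = r * t3"
    using d3 r3 by algebra
  have x1: "a * b * (c2 * s3 - s2 * c3) = r * t1"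
    using d1 r3 by algebra
  have x2: "a * b * (c3 * s1 - s3 * c1) = r * t2"
    using d2 r3 by algebra
  have r0: "r > 0"
    using ab r_def by simp
  have cross: "(a + b) * (c1 * s2 - s1 * c2) = t3" "(a + b) * (c2 * s3 - s2 * c3) = t1"
      "(a + b) * (c3 * s1 - s3 * c1) = t2"
  proof -
    have "r * ((a + b) * (c1 * s2 - s1 * c2)) = r * t3" "r * ((a + b) * (c2 * s3 - s2 * c3)) = r * t1"
        "r * ((a + b) * (c3 * s1 - s3 * c1)) = r * t2"
      using x1 x2 x3 rab by algebra+
    then show "(a + b) * (c1 * s2 - s1 * c2) = t3" "(a + b) * (c2 * s3 - s2 * c3) = t1"
      "(a + b) * (c3 * s1 - s3 * c1) = t2"
      using r0 by simp_all
  qed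
  have n1: "t2 * t3 = (a + b) * (a * c1\<^sup>2 + b * s1\<^sup>2 + r)"
    using d2 cross(1) r3 by algebra
  have n2: "t3 * t1 = (a + b) * (a * c2\<^sup>2 + b * s2\<^sup>2 + r)"
    using d3 cross(2) r3 by algebra
  have n3: "t1 * t2 = (a + b) * (a * c3\<^sup>2 + b * s3\<^sup>2 + r)"
    using d1 cross(3) r3 by algebra
  have "r * (t1 * t2 * t3) = r * (a * b * (t1 + t2 + t3))"
  proof -
    have "(a * (c2 - c1)) * (b * (s1 - s3)) - (b * (s2 - s1)) * (a * (c1 - c3)) =
        a * b * ((c1 * s2 - s1 * c2) + (c2 * s3 - s2 * c3) + (c3 * s1 - s3 * c1)) * (- 1)"
      by (simp add: algebra_simps)
    then show ?thesis
      using d2 d3 x1 x2 x3 by algebra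
  qed
  then have sum: "t1 * t2 * t3 = a * b * (t1 + t2 + t3)"
    using r0 by simp
  show thesis
    by (rule that[of t1 t2 t3])
      (use d1 d2 d3 n1 n2 n3 sum in \<open>auto simp: uvw vertex_def weight_def r_def right_diff_distrib\<close>)
qed

text \<open>
  This is Parseval's identity for the third coordinates of the orthonormal basis obtained by
  normalizing the spatial vectors. It is derived from the side lengths, since
  $1/n_u = (a+b)\,t_1/(t_1 t_2 t_3)$.
\<close>

lemma sum_inverse_weight:
  assumes "a > 0" "b > 0" "conjugate_triple a b u v w"
  shows "1 / weight a b u + 1 / weight a b v + 1 / weight a b w = (a + b) / (a * b)"
proof -
  obtain t1 t2 t3 where
    t: "t2 * t3 = (a + b) * weight a b u" "t3 * t1 = (a + b) * weight a b v"
      "t1 * t2 = (a + b) * weight a b w"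
    and sum: "t1 * t2 * t3 = a * b * (t1 + t2 + t3)"
    using conjugate_sides[OF assms] by metis
  have "t2 * t3 \<noteq> 0" "t3 * t1 \<noteq> 0"
    unfolding t using assms weight_pos[of a b u] weight_pos[of a b v] by simp_all
  then have nz: "t1 \<noteq> 0" "t2 \<noteq> 0" "t3 \<noteq> 0"
    by auto
  have "1 / weight a b u = (a + b) / (t2 * t3)" "1 / weight a b v = (a + b) / (t3 * t1)"
      "1 / weight a b w = (a + b) / (t1 * t2)"
    using t assms by simp_all
  then have "1 / weight a b u + 1 / weight a b v + 1 / weight a b w =
      (a + b) / (t2 * t3) + (a + b) / (t3 * t1) + (a + b) / (t1 * t2)"
    by simp
  also have "\<dots> = (a + b) * (t1 + t2 + t3) / (t1 * t2 * t3)"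
    using nz by (simp add: field_simps)
  also have "\<dots> = (a + b) / (a * b)"
  proof -
    have "t1 + t2 + t3 \<noteq> 0"
      using sum nz by auto
    then show ?thesis
      unfolding sum by simp
  qed
  finally show ?thesis .
qed

section \<open>The incircle family\<close>

text \<open>
  The two sides at a vertex are multiples of the scaled vectors perpendicular to $v$ and $w$. The
  multipliers cancel since their product is positive; the minus sign appears because one side is
  traversed towards the vertex and the other one away from it.
\<close>

lemma cos_angle_vertex:
  assumes ab: "a > 0" "b > 0" and triple: "conjugate_triple a b u v w"
  shows "cos (angle (vertex (s * a) b w) (vertex (s * a) b u) (vertex (s * a) b v)) =
    - (fst v * fst w + s\<^sup>2 * (snd v * snd w)) /
      (norm (s * snd v, fst v) * norm (s * snd w, fst w))"
proof -
  obtain t2 t3 where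
    side2: "vertex a b u - vertex a b w = t2 *\<^sub>R (snd v, - fst v)"
    and side3: "vertex a b v - vertex a b u = t3 *\<^sub>R (snd w, - fst w)"
    and t: "t2 * t3 = (a + b) * weight a b u"
    using conjugate_sides[OF ab triple] by metis
  have t0: "t2 * t3 > 0"
    unfolding t using ab weight_pos[of a b u] by simp
  have P: "vertex (s * a) b w - vertex (s * a) b u = (- t2) *\<^sub>R (s * snd v, - fst v)"
    using side2 by (simp add: vertex_def) algebra
  have Q: "vertex (s * a) b v - vertex (s * a) b u = t3 *\<^sub>R (s * snd w, - fst w)"
    using side3 by (simp add: vertex_def) algebra
  have "norm ((- t2) *\<^sub>R (s * snd v, - fst v)) * norm (t3 *\<^sub>R (s * snd w, - fst w)) =
      (\<bar>t2\<bar> * \<bar>t3\<bar>) * (norm (s * snd v, fst v) * norm (s * snd w, fst w))"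
    by (simp only: norm_scaleR) (simp add: norm_Pair)
  also have "\<bar>t2\<bar> * \<bar>t3\<bar> = t2 * t3"
    using t0 by (simp flip: abs_mult)
  finally have norms: "norm ((- t2) *\<^sub>R (s * snd v, - fst v)) * norm (t3 *\<^sub>R (s * snd w, - fst w)) =
      (t2 * t3) * (norm (s * snd v, fst v) * norm (s * snd w, fst w))" .
  have inner: "((- t2) *\<^sub>R (s * snd v, - fst v)) \<bullet> (t3 *\<^sub>R (s * snd w, - fst w)) =
      (t2 * t3) * - (fst v * fst w + s\<^sup>2 * (snd v * snd w))"
    by (simp add: power2_eq_square algebra_simps)
  have "t2 * t3 \<noteq> 0"
    using t0 by linarith
  then show ?thesis
    unfolding cos_angle P Q norms inner by (rule mult_divide_mult_cancel_left)
qed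

text \<open>
  Only one vertex has to be treated: $|u + v + w|^2$ is symmetric, and $v + w$ is a multiple of
  the vertex $A$ over $u$. The dependence on $u$ cancels since
  $|A|^2 = (a+b)(a c^2 + b s^2 - r)$ on the ellipse.
\<close>

lemma sum_cos_incircle:
  assumes ab: "a > 0" "b > 0" and triple: "conjugate_triple a b u v w"
  shows "cos (angle (vertex a b w) (vertex a b u) (vertex a b v)) +
      cos (angle (vertex a b u) (vertex a b v) (vertex a b w)) +
      cos (angle (vertex a b v) (vertex a b w) (vertex a b u)) = 1 + 2 * a * b / (a + b)\<^sup>2"
proof -
  define r where "r = a * b / (a + b)"
  define D where "D = (a * fst u)\<^sup>2 + (b * snd u)\<^sup>2"
  have unit: "norm u = 1" "norm v = 1" "norm w = 1"
    using triple by (simp_all add: conjugate_triple_def)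
  have conj: "conjugate a b u v" "conjugate a b u w"
    using triple by (auto simp: conjugate_triple_def conjugate_def algebra_simps)
  have cos_eq: "cos (angle (vertex a b w) (vertex a b u) (vertex a b v)) = - (v \<bullet> w)"
    if "conjugate_triple a b u v w" for u v w
  proof -
    have "norm (snd x, fst x) = norm x" for x :: point
      by (simp add: norm_prod_def add.commute)
    then show ?thesis
      using cos_angle_vertex[OF ab that, of 1] that
      by (simp add: conjugate_triple_def inner_prod_def)
  qed
  have D0: "D > 0" and sum: "D *\<^sub>R (v + w) = (- 2 * r) *\<^sub>R vertex a b u"
    using conjugate_points_sum_product[OF ab r_def unit(2,3)
        conjugate_triple_distinct[OF ab triple] conj D_def] by auto
  have vw: "v + w = (- 2 * r / D) *\<^sub>R vertex a b u"
  proof -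
    have "v + w = (1 / D) *\<^sub>R (D *\<^sub>R (v + w))"
      using D0 by simp
    then show ?thesis
      unfolding sum by simp
  qed
  have u1: "(fst u)\<^sup>2 + (snd u)\<^sup>2 = 1"
    using unit(1) by (simp add: norm_prod_def)
  have rab: "r * (a + b) = a * b"
    using ab by (simp add: r_def)
  define m where "m = a * (fst u)\<^sup>2 + b * (snd u)\<^sup>2"
  have Dm: "D = (a + b) * (m - r)"
    using u1 rab unfolding D_def m_def by algebra
  have VV: "vertex a b u \<bullet> vertex a b u = D"
    by (simp add: vertex_def D_def power2_eq_square)
  have uV: "u \<bullet> vertex a b u = m"
    by (simp add: vertex_def m_def inner_prod_def power2_eq_square algebra_simps)
  have "(v + w) \<bullet> (v + w) = 4 * r\<^sup>2 / D" "u \<bullet> (v + w) = - 2 * r * m / D"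
    unfolding vw using D0 by (simp_all add: VV uV power2_eq_square field_simps)
  then have "2 * (v \<bullet> w) = 4 * r\<^sup>2 / D - 2" "u \<bullet> v + u \<bullet> w = - 2 * r * m / D"
    using unit by (simp_all add: inner_add inner_commute[of w v] norm_eq_1)
  then have "- (v \<bullet> w) - (w \<bullet> u) - (u \<bullet> v) = 1 + 2 * r * (m - r) / D"
    by (simp add: inner_commute[of w u] power2_eq_square right_diff_distrib diff_divide_distrib)
  also have "2 * r * (m - r) / D = 2 * r / (a + b)"
  proof -
    have "m - r \<noteq> 0"
      using D0 unfolding Dm by auto
    then show ?thesis
      unfolding Dm by (rule mult_divide_mult_cancel_right)
  qed
  also have "\<dots> = 2 * a * b / (a + b)\<^sup>2"
    by (simp add: r_def power2_eq_square)
  finally show ?thesis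
    using cos_eq[OF triple] cos_eq[OF conjugate_triple_rotate[OF triple]]
      cos_eq[OF conjugate_triple_rotate[OF conjugate_triple_rotate[OF triple]]]
    by simp
qed

section \<open>The confocal family\<close>

text \<open>
  The witness is the triangle with one vertex at $(-a, 0)$ and the opposite side on the vertical
  tangent $x = r$. For its vertex $(r, y)$ the side from $(-a, 0)$ touches the circle at $-r$ times
  the unit vector of the third vertex $(r, -y)$, as each side is perpendicular to the unit vector of
  the opposite vertex.
\<close>

lemma incircle_family_nonempty:
  assumes ab: "a > 0" "b > 0"
  shows "incircle_family a b \<noteq> {}"
proof -
  define r where "r = a * b / (a + b)"
  define h where "h = b * sqrt (1 - r\<^sup>2 / a\<^sup>2)"
  have r: "r > 0" "r < a" "r * (a + b) = a * b"
    using ab by (auto simp: r_def field_simps)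
  have "r\<^sup>2 < a\<^sup>2"
    using r by (simp add: power_strict_mono)
  then have r2: "r\<^sup>2 / a\<^sup>2 < 1"
    using ab by simp
  then have h0: "h > 0"
    using ab by (simp add: h_def)
  have "h\<^sup>2 = b\<^sup>2 * (1 - r\<^sup>2 / a\<^sup>2)"
    using r2 by (simp add: h_def power_mult_distrib)
  then have ellipse_h: "r\<^sup>2 / a\<^sup>2 + h\<^sup>2 / b\<^sup>2 = 1"
    using ab by simp
  have tangent: "side_tangent_ellipse (- a, 0) (r, y) r r" if y: "y\<^sup>2 = h\<^sup>2" for y
    unfolding side_tangent_ellipse_iff
  proof (intro bexI IntI)
    let ?z = "(- (r\<^sup>2 / a), r * y / b) :: point"
    have "(r\<^sup>2 / a)\<^sup>2 + (r * y / b)\<^sup>2 = r\<^sup>2 * (r\<^sup>2 / a\<^sup>2 + h\<^sup>2 / b\<^sup>2)"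
      by (simp add: y power_mult_distrib power_divide distrib_left power2_eq_square[of "r\<^sup>2"])
    then have "(r\<^sup>2 / a)\<^sup>2 + (r * y / b)\<^sup>2 = r\<^sup>2"
      unfolding ellipse_h by simp
    then show "?z \<in> ellipse r r"
      using r(1) by (simp add: ellipse_def ellipse_fun_def flip: add_divide_distrib)
    have t: "(a - r) / a = r / b"
      using r ab by (simp add: field_simps)
    show "?z \<in> closed_segment (- a, 0) (r, y)"
      unfolding closed_segment_def
    proof (intro CollectI exI conjI)
      have "- (r\<^sup>2 / a) = (1 - (a - r) / a) * - a + (a - r) / a * r"
        using ab by (simp add: field_simps power2_eq_square)
      moreover have "r * y / b = (a - r) / a * y"
        unfolding t by simp
      ultimately show "?z = (1 - (a - r) / a) *\<^sub>R (- a, 0) + ((a - r) / a) *\<^sub>R (r, y)"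
        by simp
      show "0 \<le> (a - r) / a" "(a - r) / a \<le> 1"
        using r ab by (auto simp: field_simps)
    qed
    have "h\<^sup>2 / b\<^sup>2 = (a - r) / a * ((a + r) / a)"
      using ellipse_h ab by (simp add: field_simps power2_eq_square)
    then have "h\<^sup>2 / b\<^sup>2 = r / b * ((a + r) / a)"
      unfolding t .
    moreover have "r * h\<^sup>2 / b = r * b * (h\<^sup>2 / b\<^sup>2)"
      using ab by (simp add: power2_eq_square)
    ultimately have "r * h\<^sup>2 / b = r\<^sup>2 / a * (a + r)"
      using ab by (simp add: power2_eq_square)
    then have "- (r\<^sup>2 / a) * (r + a) + r * y / b * y = 0"
      using y by (simp add: power2_eq_square algebra_simps)
    then show "fst ?z * fst ((r, y) - (- a, 0)) / r\<^sup>2 + snd ?z * snd ((r, y) - (- a, 0)) / r\<^sup>2 = 0"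
      by (simp flip: add_divide_distrib)
  qed
  have vertical: "side_tangent_ellipse (r, h) (r, - h) r r"
    unfolding side_tangent_ellipse_iff
  proof (intro bexI IntI)
    show "(r, 0) \<in> ellipse r r"
      using r by (simp add: ellipse_def ellipse_fun_def)
    have "midpoint (r, h) (r, - h) = (r, 0)"
      by (simp add: midpoint_def)
    then show "(r, 0) \<in> closed_segment (r, h) (r, - h)"
      by (metis midpoint_in_closed_segment)
  qed simp
  have noncollinear: "\<not> collinear {(- a, 0), (r, h), (r, - h)}"
  proof
    assume "collinear {(- a, 0), (r, h), (r, - h)}"
    then obtain d c c' where d: "(r, h) - (r, - h) = c *\<^sub>R d" "(r, h) - (- a, 0) = c' *\<^sub>R d"
      unfolding collinear_def by blast
    obtain x y where "d = (x, y)"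
      by (cases d)
    then have "0 = c * x" "2 * h = c * y" "r + a = c' * x"
      using d by auto
    then show False
      using h0 r ab by auto
  qed
  have "((- a, 0), (r, h), (r, - h)) \<in> incircle_family a b"
    using noncollinear vertical tangent[of h] tangent[of "- h"] ellipse_h ab
      side_tangent_ellipse_commute
    by (auto simp: incircle_family_def inscribed_circumscribed_def ellipse_def ellipse_fun_def
        simp flip: r_def)
  then show ?thesis
    by blast
qed

lemma foci_eqI:
  assumes "p > 0" "q > 0" "p' > 0" "q' > 0" "p\<^sup>2 - q\<^sup>2 = p'\<^sup>2 - q'\<^sup>2"
  shows "foci p q = foci p' q'"
proof -
  have "q \<le> p \<longleftrightarrow> q\<^sup>2 \<le> p\<^sup>2" "q' \<le> p' \<longleftrightarrow> q'\<^sup>2 \<le> p'\<^sup>2"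
    using assms by (auto simp: power2_le_iff_abs_le)
  then have "q \<le> p \<longleftrightarrow> q' \<le> p'" and "q\<^sup>2 - p\<^sup>2 = q'\<^sup>2 - p'\<^sup>2"
    using assms(5) by linarith+
  then show ?thesis
    unfolding foci_def assms(5) by (simp only:)
qed

text \<open>
  The second equation says that the differences $s^2a^2 - b^2$ and $s^2r^2 - r^2$ of the squared
  semi-axes of the two scaled ellipses agree, that is, that these are confocal.
\<close>

lemma confocal_scaling:
  fixes a b r s :: real
  assumes ab: "a > 0" "b > 0"
    and s2: "s\<^sup>2 = (b ^ 4 + 2 * a * b ^ 3) / (a ^ 4 + 2 * b * a ^ 3)"
  shows "s\<^sup>2 * (a ^ 3 * (a + 2 * b)) = b ^ 3 * (b + 2 * a)"
    and "r = a * b / (a + b) \<Longrightarrow> s\<^sup>2 * (a\<^sup>2 - r\<^sup>2) = b\<^sup>2 - r\<^sup>2"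
proof -
  have "a ^ 4 + 2 * b * a ^ 3 = a ^ 3 * (a + 2 * b)" "b ^ 4 + 2 * a * b ^ 3 = b ^ 3 * (b + 2 * a)"
    by algebra+
  moreover have "a ^ 3 * (a + 2 * b) \<noteq> 0"
    using ab by simp
  ultimately show s2': "s\<^sup>2 * (a ^ 3 * (a + 2 * b)) = b ^ 3 * (b + 2 * a)"
    unfolding s2 by simp
  show "s\<^sup>2 * (a\<^sup>2 - r\<^sup>2) = b\<^sup>2 - r\<^sup>2" if "r = a * b / (a + b)"
  proof -
    have "r * (a + b) = a * b"
      using ab that by simp
    then have "(a + b)\<^sup>2 * (s\<^sup>2 * (a\<^sup>2 - r\<^sup>2)) = (a + b)\<^sup>2 * (b\<^sup>2 - r\<^sup>2)"
      using s2' by algebra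
    then show ?thesis
      using ab by simp
  qed
qed

text \<open>
  Here $M$ is the product of the distances of the scaled vertex from the common foci. By Vieta's
  formulas the inner product in \<open>cos_angle_vertex\<close> is $(M - 2(b^2 - r^2))/D$, and
  confocality makes the product of the two norms equal to $M/D$, without a square root.
\<close>

lemma cos_angle_confocal:
  assumes ab: "a > 0" "b > 0" and r: "r = a * b / (a + b)" and s: "s > 0"
    and confocal: "s\<^sup>2 * (a\<^sup>2 - r\<^sup>2) = b\<^sup>2 - r\<^sup>2"
    and triple: "conjugate_triple a b u v w"
    and M: "M = s\<^sup>2 * a\<^sup>2 * (snd u)\<^sup>2 + b\<^sup>2 * (fst u)\<^sup>2"
  shows "cos (angle (vertex (s * a) b w) (vertex (s * a) b u) (vertex (s * a) b v)) =
    2 * (b\<^sup>2 - r\<^sup>2) / M - 1"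
proof -
  obtain c1 s1 c2 s2 c3 s3 where uvw: "u = (c1, s1)" "v = (c2, s2)" "w = (c3, s3)"
    by (cases u, cases v, cases w)
  have unit: "norm u = 1" "norm v = 1" "norm w = 1"
    using triple by (simp_all add: conjugate_triple_def)
  then have cs: "c1\<^sup>2 + s1\<^sup>2 = 1" "c2\<^sup>2 + s2\<^sup>2 = 1" "c3\<^sup>2 + s3\<^sup>2 = 1"
    by (auto simp: uvw norm_Pair)
  have conj: "conjugate a b u v" "conjugate a b u w"
    using triple by (auto simp: conjugate_triple_def conjugate_def algebra_simps)
  define D where "D = (a * fst u)\<^sup>2 + (b * snd u)\<^sup>2"
  note sp = conjugate_points_sum_product[OF ab r unit(2,3)
        conjugate_triple_distinct[OF ab triple] conj D_def]
  have D0: "D > 0"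
    by (rule sp(4))
  have D': "D = a\<^sup>2 * c1\<^sup>2 + b\<^sup>2 * s1\<^sup>2"
    by (simp add: D_def uvw power_mult_distrib)
  have cc: "D * (c2 * c3) = r\<^sup>2 - b\<^sup>2 * s1\<^sup>2" and ss: "D * (s2 * s3) = r\<^sup>2 - a\<^sup>2 * c1\<^sup>2"
    using sp(2,3) by (simp_all add: uvw power_mult_distrib)
  have M': "M = s\<^sup>2 * a\<^sup>2 * s1\<^sup>2 + b\<^sup>2 * c1\<^sup>2"
    by (simp add: M uvw)
  have M0: "M > 0"
  proof -
    have "M = (s * a * s1)\<^sup>2 + (b * c1)\<^sup>2"
      by (simp add: M' power_mult_distrib)
    moreover have "s * a * s1 \<noteq> 0 \<or> b * c1 \<noteq> 0"
      using cs(1) ab s by auto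
    ultimately show ?thesis
      by (simp add: sum_power2_gt_zero_iff)
  qed
  \<comment> \<open>I and s * X are the inner and cross product of the two vectors whose norms are needed.\<close>
  define I where "I = c2 * c3 + s\<^sup>2 * (s2 * s3)"
  define X where "X = c2 * s3 - s2 * c3"
  have DI: "D * I = M - 2 * (b\<^sup>2 - r\<^sup>2)"
    using cc ss confocal cs(1) unfolding I_def M' by algebra
  have DX: "(D * X)\<^sup>2 = 4 * r\<^sup>2 * (D - r\<^sup>2)"
  proof -
    have "X\<^sup>2 = 1 - (c2 * c3 + s2 * s3)\<^sup>2"
      using cs(2,3) unfolding X_def by algebra
    moreover have "D * (c2 * c3 + s2 * s3) = 2 * r\<^sup>2 - D"
      using cc ss D' by (simp add: distrib_left)
    ultimately show ?thesis
      by algebra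
  qed
  have "D\<^sup>2 * ((c2\<^sup>2 + s\<^sup>2 * s2\<^sup>2) * (c3\<^sup>2 + s\<^sup>2 * s3\<^sup>2)) = (D * I)\<^sup>2 + s\<^sup>2 * (D * X)\<^sup>2"
    unfolding I_def X_def by algebra
  also have "\<dots> = M\<^sup>2"
    unfolding DI DX using confocal cs(1) D' M' by algebra
  finally have "(c2\<^sup>2 + s\<^sup>2 * s2\<^sup>2) * (c3\<^sup>2 + s\<^sup>2 * s3\<^sup>2) = (M / D)\<^sup>2"
    using D0 by (simp add: field_simps)
  then have "norm (s * s2, c2) * norm (s * s3, c3) = M / D"
    using D0 M0 by (simp add: norm_Pair power_mult_distrib add.commute flip: real_sqrt_mult)
  then have "cos (angle (vertex (s * a) b w) (vertex (s * a) b u) (vertex (s * a) b v)) =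
      - I / (M / D)"
    using cos_angle_vertex[OF ab triple, of s] by (simp add: uvw I_def)
  also have "\<dots> = - (D * I) / M"
    by simp
  also have "\<dots> = 2 * (b\<^sup>2 - r\<^sup>2) / M - 1"
    unfolding DI using M0 by (simp add: field_simps)
  finally show ?thesis .
qed

text \<open>
  For this scaling factor the product of the focal distances of a scaled vertex is a constant
  multiple $L$ of the weight, so the sum of the cosines reduces to the sum of the inverse weights.
\<close>

lemma sum_cos_confocal:
  assumes ab: "a > 0" "b > 0" and s: "s > 0"
    and s2: "s\<^sup>2 = (b ^ 4 + 2 * a * b ^ 3) / (a ^ 4 + 2 * b * a ^ 3)"
    and triple: "conjugate_triple a b u v w"
  shows "cos (angle (vertex (s * a) b w) (vertex (s * a) b u) (vertex (s * a) b v)) +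
      cos (angle (vertex (s * a) b u) (vertex (s * a) b v) (vertex (s * a) b w)) +
      cos (angle (vertex (s * a) b v) (vertex (s * a) b w) (vertex (s * a) b u)) =
      1 + 2 * a * b / (a + b)\<^sup>2"
proof -
  define r where "r = a * b / (a + b)"
  define L where "L = b\<^sup>2 * (a + b) / (a * (a + 2 * b))"
  have rab: "r * (a + b) = a * b"
    using ab by (simp add: r_def)
  note s2' = confocal_scaling(1)[OF ab s2] and confocal = confocal_scaling(2)[OF ab s2 r_def]
  have M: "s\<^sup>2 * a\<^sup>2 * (snd x)\<^sup>2 + b\<^sup>2 * (fst x)\<^sup>2 = L * weight a b x" if "norm x = 1" for x
  proof -
    have x1: "(fst x)\<^sup>2 + (snd x)\<^sup>2 = 1"
      using that by (simp add: norm_prod_def)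
    have n: "weight a b x = a * (fst x)\<^sup>2 + b * (snd x)\<^sup>2 + r"
      by (simp add: weight_def r_def)
    have L: "L * (a * (a + 2 * b)) = b\<^sup>2 * (a + b)"
      using ab by (simp add: L_def)
    have "a * (a + 2 * b) * (s\<^sup>2 * a\<^sup>2 * (snd x)\<^sup>2 + b\<^sup>2 * (fst x)\<^sup>2) =
        a * (a + 2 * b) * (L * weight a b x)"
      using x1 L s2' rab unfolding n by algebra
    then show ?thesis
      using ab by simp
  qed
  have cos_eq: "cos (angle (vertex (s * a) b w) (vertex (s * a) b u) (vertex (s * a) b v)) =
      2 * (b\<^sup>2 - r\<^sup>2) / L * (1 / weight a b u) - 1" if "conjugate_triple a b u v w" for u v w
    using cos_angle_confocal[OF ab r_def s confocal that refl] M[of u] that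
    by (simp add: conjugate_triple_def)
  have "cos (angle (vertex (s * a) b w) (vertex (s * a) b u) (vertex (s * a) b v)) +
      cos (angle (vertex (s * a) b u) (vertex (s * a) b v) (vertex (s * a) b w)) +
      cos (angle (vertex (s * a) b v) (vertex (s * a) b w) (vertex (s * a) b u)) =
      2 * (b\<^sup>2 - r\<^sup>2) / L * (1 / weight a b u + 1 / weight a b v + 1 / weight a b w) - 3"
    using cos_eq[OF triple] cos_eq[OF conjugate_triple_rotate[OF triple]]
      cos_eq[OF conjugate_triple_rotate[OF conjugate_triple_rotate[OF triple]]]
    unfolding distrib_left by linarith
  also have "\<dots> = 2 * (b\<^sup>2 - r\<^sup>2) / L * ((a + b) / (a * b)) - 3"
    by (simp only: sum_inverse_weight[OF ab triple])
  also have "\<dots> = 1 + 2 * a * b / (a + b)\<^sup>2"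
  proof -
    have "b\<^sup>2 - r\<^sup>2 = b ^ 3 * (b + 2 * a) / (a + b)\<^sup>2"
    proof -
      have "(b\<^sup>2 - r\<^sup>2) * (a + b)\<^sup>2 = b ^ 3 * (b + 2 * a)"
        using rab by algebra
      then show ?thesis
        using ab by (simp add: eq_divide_eq)
    qed
    moreover have "(a + b) / (a * b) / L = (a + 2 * b) / b ^ 3"
      using ab by (simp add: L_def power2_eq_square power3_eq_cube)
    ultimately have "2 * (b\<^sup>2 - r\<^sup>2) / L * ((a + b) / (a * b)) =
        2 * (b ^ 3 * (b + 2 * a) / (a + b)\<^sup>2) * ((a + 2 * b) / b ^ 3)"
      by (metis times_divide_eq_left times_divide_eq_right mult.commute)
    also have "\<dots> = 2 * (b + 2 * a) * (a + 2 * b) / (a + b)\<^sup>2"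
      using ab by simp
    also have "\<dots> = 4 + 2 * a * b / (a + b)\<^sup>2"
    proof -
      have "2 * (b + 2 * a) * (a + 2 * b) = 4 * (a + b)\<^sup>2 + 2 * a * b"
        by algebra
      then show ?thesis
        using ab by (simp add: add_divide_distrib)
    qed
    finally show ?thesis
      by simp
  qed
  finally show ?thesis .
qed

section \<open>Constancy of the sum of cosines\<close>

theorem proposition1:
  fixes a b r s k :: real
  assumes "a \<ge> b" and "b > 0"
    and "r = a * b / (a + b)"
    and "s = sqrt ((b ^ 4 + 2 * a * b ^ 3) / (a ^ 4 + 2 * b * a ^ 3))"
    and "k = 1 + 2 * a * b / (a + b)\<^sup>2"
  shows "k = 1 + 2 * r * (a - r) / a\<^sup>2 \<and>
    is_confocal_family (scale_triangle s ` incircle_family a b) \<and>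
    (\<forall>(A, B, C) \<in> incircle_family a b \<union> scale_triangle s ` incircle_family a b.
       cos (angle C A B) + cos (angle A B C) + cos (angle B C A) = k)"
proof (intro conjI)
  have ab: "a > 0" "b > 0"
    using assms(1,2) by auto
  have ratio_pos: "(b ^ 4 + 2 * a * b ^ 3) / (a ^ 4 + 2 * b * a ^ 3) > 0"
    using ab by (intro divide_pos_pos add_pos_pos mult_pos_pos) auto
  then have s: "s > 0" and s2: "s\<^sup>2 = (b ^ 4 + 2 * a * b ^ 3) / (a ^ 4 + 2 * b * a ^ 3)"
    by (simp_all add: assms(4))
  have r: "r > 0" "r < a" "r < b"
    using ab by (auto simp: assms(3) field_simps)
  have ar: "a - r = a\<^sup>2 / (a + b)"
    using ab by (simp add: assms(3) field_simps power2_eq_square)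
  show "k = 1 + 2 * r * (a - r) / a\<^sup>2"
    unfolding ar using ab by (simp add: assms(3,5) power2_eq_square)
  have image: "scale_triangle s ` incircle_family a b = inscribed_circumscribed (s * a) b (s * r) r"
    using s image_scale_triangle_inscribed_circumscribed[of s a b r r]
    by (simp add: incircle_family_def flip: assms(3))
  have "(s * a)\<^sup>2 - b\<^sup>2 = (s * r)\<^sup>2 - r\<^sup>2"
    using confocal_scaling(2)[OF ab s2 assms(3)] by (simp add: power_mult_distrib algebra_simps)
  then have "foci (s * a) b = foci (s * r) r"
    using s ab r by (intro foci_eqI) auto
  moreover have "scale_triangle s ` incircle_family a b \<noteq> {}"
    using incircle_family_nonempty[OF ab] by simp
  ultimately show "is_confocal_family (scale_triangle s ` incircle_family a b)"
    unfolding is_confocal_family_def using s r image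
    by (intro exI[of _ "s * a"] exI[of _ b] exI[of _ "s * r"] exI[of _ r]) auto
  have incircle: "cos (angle C A B) + cos (angle A B C) + cos (angle B C A) = k"
    if T: "(A, B, C) \<in> incircle_family a b" for A B C
  proof -
    obtain u v w where "conjugate_triple a b u v w"
        "A = vertex a b u" "B = vertex a b v" "C = vertex a b w"
      using incircle_family_conjugate_triple[OF ab T] by blast
    then show ?thesis
      using sum_cos_incircle[OF ab] assms(5) by simp
  qed
  have confocal: "cos (angle C' A' B') + cos (angle A' B' C') + cos (angle B' C' A') = k"
    if T: "(A, B, C) \<in> incircle_family a b" and T': "(A', B', C') = scale_triangle s (A, B, C)"
    for A B C A' B' C'
  proof -
    obtain u v w where triple: "conjugate_triple a b u v w"
      and ABC: "A = vertex a b u" "B = vertex a b v" "C = vertex a b w"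
      using incircle_family_conjugate_triple[OF ab T] by blast
    have "scale_point s (vertex a b x) = vertex (s * a) b x" for x
      by (simp add: scale_point_def vertex_def)
    then have "A' = vertex (s * a) b u" "B' = vertex (s * a) b v" "C' = vertex (s * a) b w"
      using T' by (simp_all add: scale_triangle_def ABC)
    then show ?thesis
      using sum_cos_confocal[OF ab s s2 triple] assms(5) by simp
  qed
  show "\<forall>(A, B, C) \<in> incircle_family a b \<union> scale_triangle s ` incircle_family a b.
      cos (angle C A B) + cos (angle A B C) + cos (angle B C A) = k"
    using incircle confocal by fastforce
qed

end
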